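(* Let $d\ge 2$ and $0\le k<d$ be integers. If $k \ge \frac{d}{2}$, then there exists a compact set $K \subseteq [0,1]^d$ such that $K$ intersects each $k$-dimensional affine subspace of $\mathbb{R}^d$ that meets $[0,1]^d$, but $K+K$ is nowhere dense in $\mathbb{R}^d$.
   Context: $K+K=\{x+y : x,y\in K\}$ is the Minkowski sum. *)

theory Defs
  imports "HOL-Analysis.Analysis"
begin

definition nowhere_dense :: "'a::topological_space set \<Rightarrow> bool" where
  "nowhere_dense S \<longleftrightarrow> interior (closure S) = {}"

(* The constants 0 and 1 on vectors are componentwise, so this is [0,1]^d with d = CARD('n). *)
definition unit_cube :: "(real ^ 'n) set" where
  "unit_cube = cbox 0 1"

end

theory Submission
  imports Defs
begin

text \<open>
  An extreme point of the section of a box by a \<open>k\<close>-flat has at least \<open>k\<close> extreme coordinates, so the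
  \<open>(d - k)\<close>-skeleton of a fine cubical grid meets every \<open>k\<close>-flat that meets the cube. Call a set with
  this property full. For a suitable \<open>z\<close> off the grid, a skeleton \<open>S\<close> and \<open>z - S\<close> meet in finitely
  many points, and only if \<open>d = 2 k\<close>; at such a point two pieces of complementary coordinate
  directions cross. Inside small boxes around the crossing, both pieces are replaced by disjoint sets
  that still block all \<open>k\<close>-flats meeting the boxes: a flat that misses the lateral faces of a box is a
  graph over the remaining coordinates, so it respects affine relations between three parallel
  layers, and holes can be cut in the layers that violate such a relation. Hence every full set can be
  perturbed slightly so that its sum with itself misses a point of a given open set. Running through
  a countable basis with nested neighbourhoods of full sets, the limit \<open>K\<close> is full and \<open>K + K\<close> has
  empty interior.
\<close>

section \<open>Flats meeting a box\<close>

lemma affine_directions: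
  fixes A :: "(real ^ 'n) set"
  assumes "affine A" "x \<in> A"
  shows "subspace {v. x + v \<in> A}" and "aff_dim A = int (dim {v. x + v \<in> A})"
proof -
  have eq: "{v. x + v \<in> A} = (+) (- x) ` A"
    by (force simp: image_iff)
  show "subspace {v. x + v \<in> A}"
    unfolding eq using affine_diffs_subspace[OF assms] by simp
  show "aff_dim A = int (dim {v. x + v \<in> A})"
    unfolding eq using assms(2) by (intro aff_dim_eq_dim) (simp add: hull_inc)
qed

text \<open>Moving from \<open>x\<close> along \<open>v\<close> or \<open>- v\<close> changes only
  coordinates strictly inside their intervals, so short moves stay in the section. Unless
  \<open>v = 0\<close>, the point \<open>x\<close> would be the midpoint of a segment in it.\<close>

lemma extreme_point_box_rigid:
  fixes a b x v :: "real ^ 'n"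
  assumes A: "affine A" and ext: "x extreme_point_of (A \<inter> cbox a b)" and v: "x + v \<in> A"
    and fixed: "\<And>i. x $ i = a $ i \<or> x $ i = b $ i \<Longrightarrow> v $ i = 0"
  shows "v = 0"
proof (rule ccontr)
  assume "v \<noteq> 0"
  have x: "x \<in> A" "x \<in> cbox a b" using ext by (auto simp: extreme_point_of_def)
  have "\<exists>t>0. \<forall>s. \<bar>s\<bar> \<le> t \<longrightarrow> a $ i \<le> x $ i + s * v $ i \<and> x $ i + s * v $ i \<le> b $ i" for i
  proof (cases "v $ i = 0")
    case True
    then show ?thesis using x by (auto simp: mem_box_cart intro: exI[of _ 1])
  next
    case False
    then have lt: "a $ i < x $ i" "x $ i < b $ i"
      using fixed[of i] x(2) by (auto simp: mem_box_cart less_le)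
    define t where "t = min (x $ i - a $ i) (b $ i - x $ i) / \<bar>v $ i\<bar>"
    have "t > 0" using lt False by (simp add: t_def)
    moreover have "a $ i \<le> x $ i + s * v $ i \<and> x $ i + s * v $ i \<le> b $ i" if "\<bar>s\<bar> \<le> t" for s
    proof -
      have "\<bar>s * v $ i\<bar> \<le> min (x $ i - a $ i) (b $ i - x $ i)"
        using that False by (simp add: t_def abs_mult field_simps)
      then show ?thesis by (auto simp: abs_le_iff)
    qed
    ultimately show ?thesis by blast
  qed
  then obtain t where t: "\<And>i. t i > 0"
    and ts: "\<And>i s. \<bar>s\<bar> \<le> t i \<Longrightarrow> a $ i \<le> x $ i + s * v $ i \<and> x $ i + s * v $ i \<le> b $ i"
    by metis
  define r where "r = Min (range t)"
  have r: "r > 0" "\<And>i. r \<le> t i" using t by (auto simp: r_def)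
  have mem: "x + s *\<^sub>R v \<in> A \<inter> cbox a b" if "\<bar>s\<bar> \<le> r" for s
  proof -
    have "(1 - s) *\<^sub>R x + s *\<^sub>R (x + v) \<in> A"
      using A x(1) v by (simp add: affine_alt)
    then have "x + s *\<^sub>R v \<in> A" by (simp add: algebra_simps)
    moreover have "x + s *\<^sub>R v \<in> cbox a b"
      using ts order_trans[OF that r(2)] by (auto simp: mem_box_cart)
    ultimately show ?thesis by blast
  qed
  have "x + (-r) *\<^sub>R v \<noteq> x + r *\<^sub>R v"
    using r(1) \<open>v \<noteq> 0\<close> by (simp add: scaleR_cancel_right del: scaleR_minus_left)
  then have "midpoint (x + (-r) *\<^sub>R v) (x + r *\<^sub>R v) \<in> open_segment (x + (-r) *\<^sub>R v) (x + r *\<^sub>R v)"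
    by (simp only: midpoint_in_open_segment) simp
  moreover have "midpoint (x + (-r) *\<^sub>R v) (x + r *\<^sub>R v) = x"
    by (simp add: midpoint_def algebra_simps flip: scaleR_2)
  moreover have "x + (-r) *\<^sub>R v \<in> A \<inter> cbox a b" "x + r *\<^sub>R v \<in> A \<inter> cbox a b"
    using mem[of r] mem[of "-r"] r(1) by simp_all
  ultimately show False
    using ext unfolding extreme_point_of_def by metis
qed

text \<open>A dimension count: the vectors vanishing on \<open>S\<close> form a subspace of
  dimension \<open>CARD('n) - card S\<close>, which together with \<open>dim L\<close> exceeds
  \<open>CARD('n)\<close>.\<close>

lemma subspace_coordinate_Int:
  fixes L :: "(real ^ 'n) set"
  assumes L: "subspace L" and card: "card S < dim L"
  obtains v where "v \<in> L" "v \<noteq> 0" "\<And>i. i \<in> S \<Longrightarrow> v $ i = 0"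
proof -
  define E where "E = {v::real^'n. \<forall>i. i \<notin> - S \<longrightarrow> v $ i = 0}"
  have E: "subspace E" by (auto simp: E_def subspace_def)
  have "dim E = card (- S)"
    unfolding E_def dim_vec_eq[symmetric] by (rule dim_substandard_cart)
  also have "\<dots> = CARD('n) - card S" by (simp add: Compl_eq_Diff_UNIV card_Diff_subset)
  finally have dE: "dim E = CARD('n) - card S" .
  have "dim {x + y |x y. x \<in> L \<and> y \<in> E} + dim (L \<inter> E) = dim L + dim E"
    by (rule dim_sums_Int[OF L E])
  moreover have "dim {x + y |x y. x \<in> L \<and> y \<in> E} \<le> CARD('n)"
    by (rule dim_subset_UNIV_cart)
  moreover have "card S \<le> CARD('n)" by (simp add: card_mono)
  ultimately have "dim (L \<inter> E) \<noteq> 0" using card dE by linarith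
  then obtain v where "v \<in> L \<inter> E" "v \<noteq> 0"
    by (auto simp: dim_eq_0)
  then show ?thesis by (intro that[of v]) (auto simp: E_def)
qed

text \<open>With fewer than \<open>k\<close> extreme coordinates, some nonzero direction of
  \<open>A\<close> would vanish on all of them, against rigidity. Degenerate boxes are covered, so
  this also applies to the facets of a box.\<close>

lemma extreme_point_box_card:
  fixes a b :: "real ^ 'n"
  assumes A: "affine A" "aff_dim A = int k" and ext: "x extreme_point_of (A \<inter> cbox a b)"
  shows "k \<le> card {i. x $ i = a $ i \<or> x $ i = b $ i}"
proof (rule ccontr)
  assume "\<not> ?thesis"
  have "x \<in> A" using ext by (auto simp: extreme_point_of_def)
  note L = affine_directions[OF A(1) this]
  have "card {i. x $ i = a $ i \<or> x $ i = b $ i} < dim {v. x + v \<in> A}"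
    using L(2) A(2) \<open>\<not> k \<le> _\<close> by simp
  from subspace_coordinate_Int[OF L(1) this] obtain v where
    "v \<in> {v. x + v \<in> A}" "v \<noteq> 0" "\<And>i. i \<in> {i. x $ i = a $ i \<or> x $ i = b $ i} \<Longrightarrow> v $ i = 0"
    by blast
  with extreme_point_box_rigid[OF A(1) ext, of v] show False by simp
qed

lemma affine_box_extreme_exists:
  fixes a b :: "real ^ 'n"
  assumes "affine A" "A \<inter> cbox a b \<noteq> {}"
  obtains x where "x extreme_point_of (A \<inter> cbox a b)"
proof (rule extreme_point_exists_convex)
  show "compact (A \<inter> cbox a b)"
    using assms(1) by (simp add: affine_closed closed_Int_compact)
  show "convex (A \<inter> cbox a b)"
    using assms(1) by (simp add: affine_imp_convex convex_Int)
qed (use assms in auto)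

section \<open>Lateral faces of a box, and flats that miss them\<close>

text \<open>For \<open>card J = k\<close> this is the union of the faces of codimension
  \<open>k\<close> other than those that fix the coordinates in \<open>J\<close>.\<close>

definition side_faces :: "nat \<Rightarrow> 'n set \<Rightarrow> real ^ 'n \<Rightarrow> real ^ 'n \<Rightarrow> (real ^ 'n) set" where
  "side_faces k J a b = {x \<in> cbox a b. \<exists>T i. card T = k \<and> i \<in> T \<and> i \<notin> J \<and>
     (\<forall>t\<in>T. x $ t = a $ t \<or> x $ t = b $ t)}"

lemma side_facesI:
  fixes x a b :: "real ^ 'n"
  assumes "x \<in> cbox a b" "i \<notin> J" "x $ i = a $ i \<or> x $ i = b $ i" "0 < k"
    and card: "k \<le> card {i. x $ i = a $ i \<or> x $ i = b $ i}"
  shows "x \<in> side_faces k J a b"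
proof -
  let ?E = "{i. x $ i = a $ i \<or> x $ i = b $ i}"
  have "k - 1 \<le> card (?E - {i})" using assms by (simp add: card_Diff_singleton)
  then obtain T where T: "T \<subseteq> ?E - {i}" "card T = k - 1"
    by (meson obtain_subset_with_card_n)
  then have "card (insert i T) = k"
    using \<open>0 < k\<close> by (subst card_insert_disjoint) auto
  with T assms show ?thesis
    unfolding side_faces_def by (intro CollectI conjI exI[of _ "insert i T"] exI[of _ i]) auto
qed

lemma closed_side_faces: "closed (side_faces k J a b)"
proof -
  have "side_faces k J a b = cbox a b \<inter> (\<Union>T\<in>{T. card T = k \<and> \<not> T \<subseteq> J}. \<Inter>t\<in>T. {x. x $ t = a $ t} \<union> {x. x $ t = b $ t})"
    unfolding side_faces_def by blast
  moreover have "closed \<dots>"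
    by (intro closed_Int closed_cbox closed_UN closed_INT ballI closed_Un finite_code
        closed_Collect_eq continuous_intros) simp_all
  ultimately show ?thesis by simp
qed

text \<open>If \<open>A\<close> touched the facet through \<open>x\<close>, an extreme point of its
  section by that facet would have \<open>k\<close> extreme coordinates and also \<open>i\<close>
  among the extreme ones, and so lie on a lateral face.\<close>

lemma affine_misses_side_faces_interior:
  fixes a b :: "real ^ 'n"
  assumes A: "affine A" "aff_dim A = int k" and "0 < k"
    and miss: "A \<inter> side_faces k J a b = {}"
    and x: "x \<in> A" "x \<in> cbox a b" and i: "i \<notin> J"
  shows "a $ i < x $ i \<and> x $ i < b $ i"
proof (rule ccontr)
  assume "\<not> ?thesis"
  then have xi: "x $ i = a $ i \<or> x $ i = b $ i"
    using x(2) by (auto simp: mem_box_cart less_le)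
  \<comment> \<open>The box is collapsed to the facet by letting both bounds of coordinate
    \<open>i\<close> equal \<open>x $ i\<close>.\<close>
  define a' where "a' = (\<chi> j. if j = i then x $ i else a $ j)"
  define b' where "b' = (\<chi> j. if j = i then x $ i else b $ j)"
  have "x \<in> cbox a' b'" using x(2) by (auto simp: mem_box_cart a'_def b'_def)
  with x A(1) obtain e where e: "e extreme_point_of (A \<inter> cbox a' b')"
    using affine_box_extreme_exists by blast
  then have "e \<in> A" and e_box: "e \<in> cbox a' b'" by (auto simp: extreme_point_of_def)
  have ei: "e $ i = x $ i" using e_box by (auto simp: mem_box_cart a'_def b'_def dest: spec[of _ i])
  have "k \<le> card {j. e $ j = a' $ j \<or> e $ j = b' $ j}"
    by (rule extreme_point_box_card[OF A e])
  also have "\<dots> \<le> card {j. e $ j = a $ j \<or> e $ j = b $ j}"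
    using xi ei by (intro card_mono) (auto simp: a'_def b'_def split: if_splits)
  finally have card: "k \<le> card {j. e $ j = a $ j \<or> e $ j = b $ j}" .
  have "e \<in> cbox a b"
    unfolding mem_box_cart
  proof
    fix j show "a $ j \<le> e $ j \<and> e $ j \<le> b $ j"
      using e_box x(2) ei by (cases "j = i") (auto simp: mem_box_cart a'_def b'_def dest: spec[of _ j])
  qed
  then have "e \<in> side_faces k J a b"
    using side_facesI[of e a b i J k] i ei xi card \<open>0 < k\<close> by simp
  with miss \<open>e \<in> A\<close> show False by blast
qed

text \<open>An extreme point of the section has its extreme coordinates in \<open>J\<close>, where
  \<open>v\<close> vanishes, so rigidity applies. Thus points of \<open>A\<close> are determined by
  their coordinates in \<open>J\<close>.\<close>

lemma affine_misses_side_faces_inj: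
  fixes a b :: "real ^ 'n"
  assumes A: "affine A" "aff_dim A = int k" and "0 < k"
    and miss: "A \<inter> side_faces k J a b = {}" and ne: "A \<inter> cbox a b \<noteq> {}"
    and u: "u \<in> A" "u + v \<in> A" and v: "\<And>j. j \<in> J \<Longrightarrow> v $ j = 0"
  shows "v = 0"
proof -
  obtain e where e: "e extreme_point_of (A \<inter> cbox a b)"
    using affine_box_extreme_exists[OF A(1) ne] by blast
  then have eA: "e \<in> A" "e \<in> cbox a b" by (auto simp: extreme_point_of_def)
  have "e + v \<in> A"
    using mem_affine_3_minus[OF A(1) eA(1) u(2) u(1), of 1] by simp
  moreover have "v $ i = 0" if "e $ i = a $ i \<or> e $ i = b $ i" for i
    using affine_misses_side_faces_interior[OF A \<open>0 < k\<close> miss eA, of i] that v by force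
  ultimately show ?thesis
    by (rule extreme_point_box_rigid[OF A(1) e])
qed

text \<open>
  A line in \<open>A\<close> starting in the box cannot leave it through a coordinate outside \<open>J\<close>, as it would
  first touch a lateral face.
\<close>
lemma affine_misses_side_faces_surj:
  fixes a b :: "real ^ 'n"
  assumes A: "affine A" "aff_dim A = int k" and "0 < k" and J: "card J = k"
    and miss: "A \<inter> side_faces k J a b = {}" and ne: "A \<inter> cbox a b \<noteq> {}"
    and y: "y \<in> cbox a b"
  obtains x where "x \<in> A" "x \<in> cbox a b" "\<And>j. j \<in> J \<Longrightarrow> x $ j = y $ j"
proof -
  obtain e where e: "e \<in> A" "e \<in> cbox a b" using ne by blast
  define L where "L = {v. e + v \<in> A}"
  have L: "subspace L" "dim L = k"
    using affine_directions[OF A(1) e(1)] A(2) by (auto simp: L_def)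
  define f where "f v = (\<chi> j. if j \<in> J then v $ j else 0)" for v :: "real ^ 'n"
  have f: "linear f"
    by (rule linearI) (auto simp: f_def vec_eq_iff)
  have inj: "inj_on f L"
  proof (subst linear_inj_on_iff_eq_0[OF f L(1)], intro ballI impI)
    fix v assume "v \<in> L" "f v = 0"
    then show "v = 0"
      using affine_misses_side_faces_inj[OF A \<open>0 < k\<close> miss ne e(1), of v]
      by (auto simp: L_def f_def vec_eq_iff split: if_splits)
  qed
  define E where "E = {v::real^'n. \<forall>i. i \<notin> J \<longrightarrow> v $ i = 0}"
  \<comment> \<open>\<open>f\<close> is injective on \<open>L\<close>, and \<open>E\<close> has the
    same dimension \<open>k\<close>, so every displacement of the coordinates in \<open>J\<close> is
    realised by a direction of \<open>A\<close>.\<close>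
  have "f ` L = E"
  proof (rule subspace_dim_equal)
    show "subspace (f ` L)" by (rule linear_subspace_image[OF f L(1)])
    show "subspace E" by (auto simp: E_def subspace_def)
    show "f ` L \<subseteq> E" by (auto simp: f_def E_def)
    have "dim E = k"
      unfolding E_def dim_vec_eq[symmetric] J[symmetric] by (rule dim_substandard_cart)
    moreover have "dim (f ` L) = k"
      using dim_image_eq[OF f, of L] inj L(2) span_eq_iff[THEN iffD2, OF L(1)] by simp
    ultimately show "dim E \<le> dim (f ` L)" by simp
  qed
  moreover have "f (y - e) \<in> E" by (auto simp: f_def E_def)
  ultimately obtain v where v: "v \<in> L" "f v = f (y - e)" by (metis imageE)
  have vJ: "v $ j = y $ j - e $ j" if "j \<in> J" for j
    using arg_cong[OF v(2), of "\<lambda>w. w $ j"] that by (simp add: f_def)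
  have lineA: "e + t *\<^sub>R v \<in> A" for t
    using mem_affine[OF A(1) e(1), of "e + v" "1 - t" t] v(1) by (simp add: L_def algebra_simps)
  define T where "T = {t \<in> {0..1}. e + t *\<^sub>R v \<in> cbox a b}"
  have "T = {0..1} \<inter> (\<lambda>t. e + t *\<^sub>R v) -` cbox a b" by (auto simp: T_def)
  moreover have "closed ((\<lambda>t. e + t *\<^sub>R v) -` cbox a b)"
    by (intro closed_vimage closed_cbox continuous_intros)
  ultimately have "compact T" by (simp add: compact_Int_closed)
  moreover have "0 \<in> T" using e by (simp add: T_def)
  ultimately obtain t where t: "t \<in> T" and max: "\<And>s. s \<in> T \<Longrightarrow> s \<le> t"
    using compact_attains_sup[of T] by blast
  \<comment> \<open>Just after a maximal \<open>t < 1\<close>, coordinates outside \<open>J\<close>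
    are still strictly inside, and those in \<open>J\<close> are convex combinations of coordinates
    of \<open>e\<close> and \<open>y\<close>, so \<open>T\<close> would contain a larger
    parameter.\<close>
  have "t = 1"
  proof (rule ccontr)
    assume "t \<noteq> 1"
    then have t01: "0 \<le> t" "t < 1" using t by (auto simp: T_def)
    have "\<forall>\<^sub>F s in at_right t. i \<notin> J \<longrightarrow> a $ i < e $ i + s * v $ i \<and> e $ i + s * v $ i < b $ i" for i
    proof (cases "i \<in> J")
      case False
      have lim: "((\<lambda>s. e $ i + s * v $ i) \<longlongrightarrow> e $ i + t * v $ i) (at_right t)"
        by (intro tendsto_intros)
      have "a $ i < e $ i + t * v $ i" "e $ i + t * v $ i < b $ i"
        using affine_misses_side_faces_interior[OF A \<open>0 < k\<close> miss lineA _ False, of t] t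
        by (auto simp: T_def)
      from order_tendstoD(1)[OF lim this(1)] order_tendstoD(2)[OF lim this(2)]
      show ?thesis by eventually_elim simp
    qed simp
    then have "\<forall>\<^sub>F s in at_right t. \<forall>i. i \<notin> J \<longrightarrow> a $ i < e $ i + s * v $ i \<and> e $ i + s * v $ i < b $ i"
      by (rule eventually_all_finite)
    moreover have "\<forall>\<^sub>F s in at_right t. s < 1" "\<forall>\<^sub>F s in at_right t. t < s"
      using t01 by (auto simp: eventually_at_right_less intro: eventually_at_rightI[of t 1])
    ultimately have "\<forall>\<^sub>F s in at_right t. t < s \<and> s < 1 \<and>
      (\<forall>i. i \<notin> J \<longrightarrow> a $ i < e $ i + s * v $ i \<and> e $ i + s * v $ i < b $ i)"
      by eventually_elim blast
    then obtain s where s: "t < s" "s < 1"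
      and sI: "\<And>i. i \<notin> J \<Longrightarrow> a $ i < e $ i + s * v $ i \<and> e $ i + s * v $ i < b $ i"
      using eventually_happens[of _ "at_right t"] by (auto simp: trivial_limit_at_right_real)
    have "a $ i \<le> e $ i + s * v $ i \<and> e $ i + s * v $ i \<le> b $ i" for i
    proof (cases "i \<in> J")
      case True
      have "e $ i + s * v $ i = (1 - s) * e $ i + s * y $ i"
        by (simp add: vJ[OF True] algebra_simps)
      moreover have "a $ i \<le> e $ i" "a $ i \<le> y $ i" "e $ i \<le> b $ i" "y $ i \<le> b $ i"
        using e y by (auto simp: mem_box_cart)
      ultimately show ?thesis
        using s t01 convex_bound_le[of "e $ i" "b $ i" "y $ i" "1 - s" s]
          convex_bound_le[of "- e $ i" "- a $ i" "- y $ i" "1 - s" s] by simp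
    qed (use sI less_imp_le in blast)
    then have "s \<in> T" using s t01 by (auto simp: T_def mem_box_cart)
    with max s(1) show False by force
  qed
  with t lineA[of 1] show ?thesis
    by (intro that[of "e + v"]) (auto simp: T_def vJ)
qed

section \<open>Parallel layers with holes\<close>

text \<open>The layers are parallel to the faces omitted from \<open>side_faces\<close>. A hole is a
  slab in the single coordinate \<open>i0\<close>, so passing through it is a condition on one
  number.\<close>

definition punctured_layers ::
  "'n set \<Rightarrow> nat \<Rightarrow> (nat \<Rightarrow> real ^ 'n) \<Rightarrow> 'n \<Rightarrow> (nat \<Rightarrow> real set) \<Rightarrow> (real ^ 'n) set" where
  "punctured_layers J n y i0 H = {x. \<exists>l<n. (\<forall>j\<in>J. x $ j = y l $ j) \<and> x $ i0 \<notin> H l}"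

lemma closed_punctured_layers:
  assumes "\<And>l. open (H l)"
  shows "closed (punctured_layers J n y i0 H)"
proof -
  have "punctured_layers J n y i0 H =
      (\<Union>l<n. (\<Inter>j\<in>J. {x. x $ j = y l $ j}) \<inter> (\<lambda>x. x $ i0) -` (- H l))"
    by (auto simp: punctured_layers_def)
  moreover have "closed \<dots>"
    using assms
    by (intro closed_Int closed_UN closed_INT ballI closed_Collect_eq closed_vimage continuous_intros) auto
  ultimately show ?thesis by simp
qed

text \<open>A flat avoiding the lateral faces meets each layer at some \<open>x l\<close>, which
  must lie in the hole. As the \<open>c l\<close> sum to 0, the combination of the
  \<open>x l\<close> is a direction of \<open>A\<close>; it vanishes on \<open>J\<close>, hence
  entirely, and coordinate \<open>i0\<close> gives the relation excluded by
  \<open>holes\<close>.\<close>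

lemma affine_meets_punctured_layers:
  fixes a b :: "real ^ 'n" and y :: "nat \<Rightarrow> real ^ 'n"
  assumes A: "affine A" "aff_dim A = int k" and "0 < k" and J: "card J = k"
    and ne: "A \<inter> cbox a b \<noteq> {}"
    and y: "\<And>l. l < n \<Longrightarrow> y l \<in> cbox a b"
    and c0: "(\<Sum>l<n. c l) = 0"
    and rel: "\<And>j. j \<in> J \<Longrightarrow> (\<Sum>l<n. c l * y l $ j) = 0"
    and holes: "\<And>h. (\<And>l. l < n \<Longrightarrow> h l \<in> H l) \<Longrightarrow> (\<Sum>l<n. c l * h l) \<noteq> 0"
  shows "A \<inter> (side_faces k J a b \<union> cbox a b \<inter> punctured_layers J n y i0 H) \<noteq> {}"
proof (rule ccontr)
  assume "\<not> ?thesis"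
  then have miss: "A \<inter> side_faces k J a b = {}"
    and hole: "\<And>x l. x \<in> A \<Longrightarrow> x \<in> cbox a b \<Longrightarrow> l < n \<Longrightarrow> (\<forall>j\<in>J. x $ j = y l $ j) \<Longrightarrow> x $ i0 \<in> H l"
    by (auto simp: punctured_layers_def)
  have "\<exists>x. x \<in> A \<and> x \<in> cbox a b \<and> (\<forall>j\<in>J. x $ j = y l $ j)" if "l < n" for l
    using affine_misses_side_faces_surj[OF A \<open>0 < k\<close> J miss ne y[OF that]] by metis
  then obtain x where x: "\<And>l. l < n \<Longrightarrow> x l \<in> A \<and> x l \<in> cbox a b \<and> (\<forall>j\<in>J. x l $ j = y l $ j)"
    by metis
  obtain e where e: "e \<in> A" using ne by blast
  have L: "subspace {v. e + v \<in> A}" by (rule affine_directions(1)[OF A(1) e])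
  have eq: "(\<Sum>l<n. c l *\<^sub>R (x l - e)) = (\<Sum>l<n. c l *\<^sub>R x l)"
    using c0 by (simp add: scaleR_right_diff_distrib sum_subtractf flip: scaleR_left.sum)
  have "(\<Sum>l<n. c l *\<^sub>R (x l - e)) \<in> {v. e + v \<in> A}"
    using x by (intro subspace_sum[OF L] subspace_scale[OF L]) auto
  then have "e + (\<Sum>l<n. c l *\<^sub>R x l) \<in> A" by (simp add: eq)
  moreover have "(\<Sum>l<n. c l *\<^sub>R x l) $ j = 0" if "j \<in> J" for j
    using x rel[OF that] that by simp
  ultimately have "(\<Sum>l<n. c l *\<^sub>R x l) = 0"
    by (rule affine_misses_side_faces_inj[OF A \<open>0 < k\<close> miss ne e])
  from arg_cong[OF this, of "\<lambda>w. w $ i0"] have "(\<Sum>l<n. c l * x l $ i0) = 0" by simp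
  moreover have "x l $ i0 \<in> H l" if "l < n" for l using hole x that by blast
  ultimately show False using holes[of "\<lambda>l. x l $ i0"] by blast
qed

section \<open>Uncrossing two transversal faces\<close>

lemma mem_unit_cube: "x \<in> unit_cube \<longleftrightarrow> (\<forall>i. 0 \<le> x $ i \<and> x $ i \<le> 1)"
  by (simp add: unit_cube_def mem_box_cart)

lemma mem_cbox_clipped:
  fixes p :: "real ^ 'n"
  shows "x \<in> cbox (\<chi> i. max 0 (p $ i - r)) (\<chi> i. min 1 (p $ i + r)) \<longleftrightarrow>
    x \<in> unit_cube \<and> (\<forall>i. \<bar>x $ i - p $ i\<bar> \<le> r)"
proof -
  have "max 0 (p $ i - r) \<le> x $ i \<and> x $ i \<le> min 1 (p $ i + r) \<longleftrightarrow>
      (0 \<le> x $ i \<and> x $ i \<le> 1) \<and> \<bar>x $ i - p $ i\<bar> \<le> r" for i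
    by auto
  then show ?thesis by (simp add: mem_unit_cube mem_box_cart all_conj_distrib)
qed

text \<open>
  \<open>F\<close> replaces the face through \<open>p\<close> with the coordinates in \<open>J\<close> fixed, and \<open>z - F'\<close> the face through
  \<open>p\<close> with the complementary coordinates fixed. Layer \<open>l\<close> of \<open>F\<close> and layer \<open>m\<close> of \<open>z - F'\<close> cross in
  one place; \<open>F\<close> yields there if \<open>l = m\<close>, and \<open>F'\<close> yields otherwise. The layers of \<open>F\<close> have offsets
  \<open>0, 1, 2\<close>, those of \<open>F'\<close> have offsets \<open>0, 1, 3\<close>, and no affine map sends either triple into the other
  except for constant ones, which the pattern of the holes excludes.
\<close>
lemma crossing_gadget:
  fixes p z :: "real ^ 'n" and \<eta> :: real and J :: "'n set"
  assumes \<eta>: "0 < \<eta>" "16 * \<eta> \<le> 1" and p: "p \<in> unit_cube" and q: "z - p \<in> unit_cube"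
    and J: "card J = k" "card (- J) = k" "0 < k"
    and pI: "\<And>i. i \<notin> J \<Longrightarrow> 4 * \<eta> \<le> p $ i \<and> p $ i \<le> 1 - 4 * \<eta>"
    and qJ: "\<And>j. j \<in> J \<Longrightarrow> 4 * \<eta> \<le> z $ j - p $ j \<and> z $ j - p $ j \<le> 1 - 4 * \<eta>"
  obtains F F' where "closed F" "closed F'"
    "\<And>x. x \<in> F \<Longrightarrow> x \<in> unit_cube \<and> (\<forall>i. \<bar>x $ i - p $ i\<bar> \<le> 4 * \<eta>)"
    "\<And>x. x \<in> F' \<Longrightarrow> x \<in> unit_cube \<and> (\<forall>i. \<bar>x $ i - (z - p) $ i\<bar> \<le> 3 * \<eta>)"
    "\<And>A x. affine A \<Longrightarrow> aff_dim A = int k \<Longrightarrow> x \<in> A \<Longrightarrow> x \<in> unit_cube \<Longrightarrow>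
      \<forall>i. \<bar>x $ i - p $ i\<bar> \<le> 4 * \<eta> \<Longrightarrow> A \<inter> F \<noteq> {}"
    "\<And>A x. affine A \<Longrightarrow> aff_dim A = int k \<Longrightarrow> x \<in> A \<Longrightarrow> x \<in> unit_cube \<Longrightarrow>
      \<forall>i. \<bar>x $ i - (z - p) $ i\<bar> \<le> 3 * \<eta> \<Longrightarrow> A \<inter> F' \<noteq> {}"
    "\<And>x. x \<in> F \<Longrightarrow> z - x \<notin> F'"
    "\<And>x i. x \<in> F \<Longrightarrow> \<forall>j. j \<notin> J \<longrightarrow> x $ j = p $ j \<Longrightarrow> \<bar>x $ i - p $ i\<bar> < 3 * \<eta>"
proof -
  obtain j0 where j0: "j0 \<in> J" using J by fastforce
  have "- J \<noteq> {}" using J by auto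
  then obtain i0 where i0: "i0 \<notin> J" by blast
  \<comment> \<open>The signs shift the layers towards the interior of the cube, since
    \<open>p\<close> and \<open>z - p\<close> may lie on its boundary.\<close>
  define \<sigma> :: real where "\<sigma> = (if p $ j0 \<le> 1 / 2 then 1 else - 1)"
  define \<tau> :: real where "\<tau> = (if (z - p) $ i0 \<le> 1 / 2 then - 1 else 1)"
  define t :: "nat \<Rightarrow> real" where "t m = (if m = 2 then 3 else real m)" for m
  define y where "y l = (\<chi> i. if i = j0 then p $ i + \<sigma> * real l * \<eta> else p $ i)" for l
  define w where "w m = (\<chi> i. if i = i0 then z $ i - p $ i - \<tau> * t m * \<eta> else z $ i - p $ i)" for m
  \<comment> \<open>Hole \<open>l\<close> of \<open>F\<close> is centred where layer
    \<open>l\<close> of \<open>z - F'\<close> passes; the holes of layer \<open>m\<close> of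
    \<open>F'\<close> are where the reflected layers \<open>l \<noteq> m\<close> of \<open>F\<close>
    pass. The radius keeps errors below \<open>\<eta>\<close> in relations whose absolute
    coefficients sum to at most 6.\<close>
  define H where "H l = ball (p $ i0 + \<tau> * t l * \<eta>) (\<eta> / 6)" for l
  define H' where "H' m = (\<Union>l\<in>{..<3} - {m}. ball (z $ j0 - p $ j0 - \<sigma> * real l * \<eta>) (\<eta> / 6))" for m
  \<comment> \<open>The larger radius 4 puts the lateral faces of \<open>F\<close> outside the
    reflected box of \<open>F'\<close>; the radius 3 puts those of \<open>F'\<close> beyond the
    layers of \<open>F\<close>, whose offsets are at most \<open>2 * \<eta>\<close>.\<close>
  define a where "a = (\<chi> i. max 0 (p $ i - 4 * \<eta>))"
  define b where "b = (\<chi> i. min 1 (p $ i + 4 * \<eta>))"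
  define a' where "a' = (\<chi> i. max 0 ((z - p) $ i - 3 * \<eta>))"
  define b' where "b' = (\<chi> i. min 1 ((z - p) $ i + 3 * \<eta>))"
  note box = mem_cbox_clipped[of _ p "4 * \<eta>", folded a_def b_def]
  note box' = mem_cbox_clipped[of _ "z - p" "3 * \<eta>", folded a'_def b'_def]
  define F where "F = side_faces k J a b \<union> cbox a b \<inter> punctured_layers J 3 y i0 H"
  define F' where "F' = side_faces k (- J) a' b' \<union> cbox a' b' \<inter> punctured_layers (- J) 3 w j0 H'"
  have lt3: "l < 3 \<longleftrightarrow> l = 0 \<or> l = 1 \<or> l = 2" for l :: nat by auto
  have sum3: "(\<Sum>l<3. g l) = g 0 + g 1 + g 2" for g :: "nat \<Rightarrow> real"
    by (simp add: numeral_3_eq_3 numeral_2_eq_2)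
  have p01: "0 \<le> p $ i" "p $ i \<le> 1" and q01: "p $ i \<le> z $ i" "z $ i - p $ i \<le> 1" for i
    using p q by (auto simp: mem_unit_cube)
  have y_near: "\<bar>y l $ i - p $ i\<bar> \<le> 2 * \<eta>" if "l < 3" for l i
    using that \<eta> by (auto simp: y_def lt3 \<sigma>_def)
  have F_box: "F \<subseteq> cbox a b" and F'_box: "F' \<subseteq> cbox a' b'"
    by (auto simp: F_def F'_def side_faces_def)
  \<comment> \<open>By \<open>pI\<close>, clipping to the cube does not affect the coordinates
    outside \<open>J\<close>.\<close>
  have sideF: "\<exists>i. i \<notin> J \<and> \<bar>x $ i - p $ i\<bar> = 4 * \<eta>" if xs: "x \<in> side_faces k J a b" for x
  proof -
    obtain i where i: "i \<notin> J" "x $ i = a $ i \<or> x $ i = b $ i"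
      using xs unfolding side_faces_def by blast
    then show ?thesis using pI[OF i(1)] \<eta>(1) by (intro exI[of _ i]) (auto simp: a_def b_def)
  qed
  have sideF': "\<exists>j. j \<in> J \<and> \<bar>x $ j - (z - p) $ j\<bar> = 3 * \<eta>" if xs: "x \<in> side_faces k (- J) a' b'" for x
  proof -
    obtain j where j: "j \<in> J" "x $ j = a' $ j \<or> x $ j = b' $ j"
      using xs unfolding side_faces_def by blast
    then show ?thesis using qJ[OF j(1)] \<eta>(1) by (intro exI[of _ j]) (auto simp: a'_def b'_def)
  qed
  show ?thesis
  proof (rule that[of F F'])
    show "closed F" "closed F'"
      unfolding F_def F'_def
      by (intro closed_Un closed_side_faces closed_Int closed_cbox closed_punctured_layers;
          auto simp: H_def H'_def)+
    show "x \<in> unit_cube \<and> (\<forall>i. \<bar>x $ i - p $ i\<bar> \<le> 4 * \<eta>)" if "x \<in> F" for x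
      using that F_box box by blast
    show "x \<in> unit_cube \<and> (\<forall>i. \<bar>x $ i - (z - p) $ i\<bar> \<le> 3 * \<eta>)" if "x \<in> F'" for x
      using that F'_box box' by blast
    show "A \<inter> F \<noteq> {}" if A: "affine A" "aff_dim A = int k" and x: "x \<in> A" "x \<in> unit_cube"
      "\<forall>i. \<bar>x $ i - p $ i\<bar> \<le> 4 * \<eta>" for A x
      unfolding F_def
    \<comment> \<open>The coefficients 1, -2, 1 annihilate the offsets 0, 1, 2, but on the hole
      centres 0, 1, 3 they give one unit \<open>\<eta>\<close> up to sign.\<close>
    proof (rule affine_meets_punctured_layers[where c = "\<lambda>l. if l = 1 then - 2 else 1", OF A J(3,1)])
      show "A \<inter> cbox a b \<noteq> {}" using x box by blast
      show "y l \<in> cbox a b" if "l < 3" for l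
        unfolding box mem_unit_cube
      proof (intro conjI allI)
        fix i
        show "\<bar>y l $ i - p $ i\<bar> \<le> 4 * \<eta>" using y_near[OF that, of i] \<eta> by linarith
        show "0 \<le> y l $ i" "y l $ i \<le> 1"
          using that p01[of i] \<eta> by (auto simp: y_def lt3 \<sigma>_def)
      qed
      show "(\<Sum>l<3. (if l = 1 then - 2 else 1) * h l) \<noteq> 0" if h: "\<And>l. l < 3 \<Longrightarrow> h l \<in> H l" for h
      proof -
        have near: "\<bar>p $ i0 - h 0\<bar> < \<eta> / 6" "\<bar>p $ i0 + \<tau> * \<eta> - h 1\<bar> < \<eta> / 6"
          "\<bar>p $ i0 + 3 * (\<tau> * \<eta>) - h 2\<bar> < \<eta> / 6"
          using h[of 0] h[of 1] h[of 2] by (auto simp: H_def t_def dist_real_def algebra_simps)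
        have "\<tau> * \<eta> = \<eta> \<or> \<tau> * \<eta> = - \<eta>" by (simp add: \<tau>_def)
        then have "h 0 - 2 * h 1 + h 2 \<noteq> 0"
          by (elim disjE; use near \<eta>(1) in linarith)
        then show ?thesis by (simp add: sum3)
      qed
    qed (auto simp: sum3 y_def algebra_simps)
    show "A \<inter> F' \<noteq> {}" if A: "affine A" "aff_dim A = int k" and x: "x \<in> A" "x \<in> unit_cube"
      "\<forall>i. \<bar>x $ i - (z - p) $ i\<bar> \<le> 3 * \<eta>" for A x
      unfolding F'_def
    \<comment> \<open>The coefficients 2, -3, 1 annihilate the offsets 0, 1, 3, but give a nonzero
      integer for any hole offsets chosen from {1, 2}, {0, 2} and {0, 1}.\<close>
    proof (rule affine_meets_punctured_layers[where c = "\<lambda>l. if l = 0 then 2 else if l = 1 then - 3 else 1",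
          OF A J(3,2)])
      show "A \<inter> cbox a' b' \<noteq> {}" using x box' by blast
      show "w l \<in> cbox a' b'" if "l < 3" for l
        unfolding box' mem_unit_cube
      proof (intro conjI allI)
        fix i
        show "\<bar>w l $ i - (z - p) $ i\<bar> \<le> 3 * \<eta>" "0 \<le> w l $ i" "w l $ i \<le> 1"
          using that q01[of i] \<eta> by (auto simp: w_def lt3 \<tau>_def t_def)
      qed
      show "(\<Sum>l<3. (if l = 0 then 2 else if l = 1 then - 3 else 1) * h l) \<noteq> 0"
        if h: "\<And>l. l < 3 \<Longrightarrow> h l \<in> H' l" for h
      proof -
        have "\<exists>l<3. l \<noteq> m \<and> \<bar>z $ j0 - p $ j0 - \<sigma> * real l * \<eta> - h m\<bar> < \<eta> / 6" if "m < 3" for m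
          using h[OF that] by (auto simp: H'_def dist_real_def)
        from this[of 0] this[of 1] this[of 2]
        have "\<bar>z $ j0 - p $ j0 - \<sigma> * \<eta> - h 0\<bar> < \<eta> / 6 \<or> \<bar>z $ j0 - p $ j0 - 2 * (\<sigma> * \<eta>) - h 0\<bar> < \<eta> / 6"
          "\<bar>z $ j0 - p $ j0 - h 1\<bar> < \<eta> / 6 \<or> \<bar>z $ j0 - p $ j0 - 2 * (\<sigma> * \<eta>) - h 1\<bar> < \<eta> / 6"
          "\<bar>z $ j0 - p $ j0 - h 2\<bar> < \<eta> / 6 \<or> \<bar>z $ j0 - p $ j0 - \<sigma> * \<eta> - h 2\<bar> < \<eta> / 6"
          by (auto simp: lt3 algebra_simps)
        moreover have "\<sigma> * \<eta> = \<eta> \<or> \<sigma> * \<eta> = - \<eta>" by (simp add: \<sigma>_def)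
        ultimately have "2 * h 0 - 3 * h 1 + h 2 \<noteq> 0"
          by (elim disjE; use \<eta>(1) in linarith)
        then show ?thesis by (simp add: sum3)
      qed
    qed (auto simp: sum3 w_def t_def algebra_simps)
    show "z - x \<notin> F'" if xF: "x \<in> F" for x
    proof
      assume xF': "z - x \<in> F'"
      then have near: "\<bar>x $ i - p $ i\<bar> \<le> 3 * \<eta>" for i
        using F'_box box' by (force simp: abs_minus_commute)
      have "x \<notin> side_faces k J a b"
      proof
        assume "x \<in> side_faces k J a b"
        then obtain i where "\<bar>x $ i - p $ i\<bar> = 4 * \<eta>" using sideF by blast
        then show False using near[of i] \<eta>(1) by simp
      qed
      then obtain l where l: "l < 3" "\<And>j. j \<in> J \<Longrightarrow> x $ j = y l $ j" "x $ i0 \<notin> H l"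
        using xF unfolding F_def punctured_layers_def by blast
      have "z - x \<notin> side_faces k (- J) a' b'"
      proof
        assume "z - x \<in> side_faces k (- J) a' b'"
        then obtain j where j: "j \<in> J" "\<bar>x $ j - p $ j\<bar> = 3 * \<eta>"
          using sideF'[of "z - x"] by (auto simp: abs_minus_commute)
        then show False using l(2)[OF j(1)] y_near[OF l(1), of j] \<eta>(1) by simp
      qed
      then obtain m where m: "m < 3" "\<And>j. j \<notin> J \<Longrightarrow> (z - x) $ j = w m $ j" "(z - x) $ j0 \<notin> H' m"
        using xF' unfolding F'_def punctured_layers_def by blast
      \<comment> \<open>This is the centre of hole \<open>m\<close>, while \<open>x\<close> avoids
        hole \<open>l\<close>. So \<open>m \<noteq> l\<close>, which puts \<open>z - x\<close> into
        a hole of \<open>F'\<close>.\<close>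
      have "x $ i0 = p $ i0 + \<tau> * t m * \<eta>" using m(2)[OF i0] by (simp add: w_def)
      then have "m \<noteq> l" using l(3) \<eta>(1) by (auto simp: H_def)
      then have "l \<in> {..<3} - {m}" using l(1) by simp
      moreover have zx: "(z - x) $ j0 = z $ j0 - p $ j0 - \<sigma> * real l * \<eta>"
        using l(2)[OF j0] by (simp add: y_def)
      ultimately have "(z - x) $ j0 \<in> H' m"
        unfolding zx H'_def using \<eta>(1) by (intro UN_I[of l]) simp_all
      then show False using m(3) by blast
    qed
    show "\<bar>x $ i - p $ i\<bar> < 3 * \<eta>" if xF: "x \<in> F" and eq: "\<forall>j. j \<notin> J \<longrightarrow> x $ j = p $ j" for x i
    proof -
      have "x \<notin> side_faces k J a b" using sideF[of x] eq \<eta>(1) by fastforce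
      then obtain l where l: "l < 3" "\<And>j. j \<in> J \<Longrightarrow> x $ j = y l $ j"
        using xF unfolding F_def punctured_layers_def by blast
      then show ?thesis using y_near[OF l(1), of i] eq \<eta>(1) by (cases "i \<in> J") auto
    qed
  qed
qed

section \<open>Perturbing a set that meets all flats\<close>

text \<open>Sets with this property are the full sets.\<close>

definition hits_flats :: "nat \<Rightarrow> (real ^ 'n) set \<Rightarrow> bool" where
  "hits_flats k K \<longleftrightarrow>
     (\<forall>A. affine A \<and> aff_dim A = int k \<and> A \<inter> unit_cube \<noteq> {} \<longrightarrow> K \<inter> A \<noteq> {})"

lemma compact_unit_cube: "compact unit_cube"
  by (simp add: unit_cube_def)

section \<open>Cubical grids and their skeletons\<close>

lemma finite_lattice_unit_cube:
  fixes g :: real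
  assumes "g > 0"
  shows "finite {p :: real ^ 'n. p \<in> unit_cube \<and> (\<forall>i. p $ i / g \<in> \<int>)}"
proof (rule finite_subset)
  let ?S = "PiE (UNIV :: 'n set) (\<lambda>_. {0..\<lfloor>1 / g\<rfloor>})"
  show "finite ((\<lambda>f. \<chi> i. g * of_int (f i)) ` ?S :: (real ^ 'n) set)"
    by (intro finite_imageI finite_PiE) auto
  show "{p. p \<in> unit_cube \<and> (\<forall>i. p $ i / g \<in> \<int>)} \<subseteq> (\<lambda>f. \<chi> i. g * of_int (f i)) ` ?S"
  proof
    fix p :: "real ^ 'n" assume p: "p \<in> {p. p \<in> unit_cube \<and> (\<forall>i. p $ i / g \<in> \<int>)}"
    have "p = (\<chi> i. g * of_int \<lfloor>p $ i / g\<rfloor>)"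
      using p assms by (auto simp: vec_eq_iff)
    moreover have "(\<lambda>i. \<lfloor>p $ i / g\<rfloor>) \<in> ?S"
      using p assms by (auto simp: mem_unit_cube intro!: floor_mono divide_right_mono)
    ultimately show "p \<in> (\<lambda>f. \<chi> i. g * of_int (f i)) ` ?S" by (rule image_eqI)
  qed
qed

lemma floor_lattice_bounds:
  fixes h t :: real
  assumes "h > 0"
  shows "h * of_int \<lfloor>t / h\<rfloor> \<le> t" and "t \<le> h * of_int \<lfloor>t / h\<rfloor> + h"
proof -
  define n where "n = \<lfloor>t / h\<rfloor>"
  have "of_int n \<le> t / h" "t / h \<le> of_int n + 1" unfolding n_def by linarith+
  then show "h * of_int \<lfloor>t / h\<rfloor> \<le> t" "t \<le> h * of_int \<lfloor>t / h\<rfloor> + h"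
    using assms unfolding n_def[symmetric]
    by (simp_all add: pos_le_divide_eq pos_divide_le_eq algebra_simps)
qed

lemma dist_le_CARD_times:
  fixes x y :: "real ^ 'n"
  assumes "\<And>i. \<bar>x $ i - y $ i\<bar> \<le> r"
  shows "dist x y \<le> real CARD('n) * r"
proof -
  have "dist x y \<le> (\<Sum>i\<in>UNIV. \<bar>(x - y) $ i\<bar>)"
    unfolding dist_norm by (rule norm_le_l1_cart)
  also have "\<dots> \<le> (\<Sum>i\<in>(UNIV :: 'n set). r)"
    by (intro sum_mono) (simp add: assms)
  finally show ?thesis by simp
qed

lemma open_sup_ball: "open {x :: real ^ 'n. \<forall>i. \<bar>x $ i - p $ i\<bar> < r}"
proof -
  have "{x :: real ^ 'n. \<forall>i. \<bar>x $ i - p $ i\<bar> < r} = (\<Inter>i\<in>UNIV. {x. \<bar>x $ i - p $ i\<bar> < r})"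
    by blast
  moreover have "open \<dots>"
    by (intro open_INT ballI open_Collect_less continuous_intros) simp
  ultimately show ?thesis by (simp only:)
qed

text \<open>A flat through \<open>y\<close> in \<open>K\<close> meets the grid cell of
  \<open>y\<close>, and an extreme point of that section has \<open>k\<close> coordinates on the
  grid. So the part of the skeleton near \<open>K\<close> is already full.\<close>

lemma lattice_skeleton:
  fixes K :: "(real ^ 'n) set"
  assumes K: "compact K" "K \<subseteq> unit_cube" "hits_flats k K" and h: "h > 0" "1 / h \<in> \<int>"
  defines "K1 \<equiv> {x \<in> unit_cube. (\<exists>T. card T = k \<and> (\<forall>i\<in>T. x $ i / h \<in> \<int>)) \<and>
    (\<exists>y\<in>K. \<forall>i. \<bar>x $ i - y $ i\<bar> \<le> h)}"
  shows "closed K1" and "hits_flats k K1"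
proof -
  let ?c = "(\<chi> i. h) :: real ^ 'n"
  have eq: "K1 = unit_cube \<inter> (\<Union>T\<in>{T. card T = k}. \<Inter>i\<in>T. (\<lambda>x. x $ i / h) -` \<int>) \<inter>
      (\<Union>x\<in>K. \<Union>y\<in>cbox (- ?c) ?c. {x + y})" (is "_ = _ \<inter> _ \<inter> ?N")
  proof -
    have "x \<in> ?N \<longleftrightarrow> (\<exists>y\<in>K. \<forall>i. \<bar>x $ i - y $ i\<bar> \<le> h)" for x
    proof
      assume "x \<in> ?N"
      then obtain y v where "y \<in> K" "v \<in> cbox (- ?c) ?c" "x = y + v" by blast
      then show "\<exists>y\<in>K. \<forall>i. \<bar>x $ i - y $ i\<bar> \<le> h"
        by (intro bexI[of _ y]) (auto simp: mem_box_cart abs_le_iff minus_le_iff)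
    next
      assume "\<exists>y\<in>K. \<forall>i. \<bar>x $ i - y $ i\<bar> \<le> h"
      then obtain y where "y \<in> K" and y: "\<And>i. \<bar>x $ i - y $ i\<bar> \<le> h" by blast
      moreover have "x - y \<in> cbox (- ?c) ?c"
        unfolding mem_box_cart
      proof
        fix i show "(- ?c) $ i \<le> (x - y) $ i \<and> (x - y) $ i \<le> ?c $ i"
          using y[of i] by (simp add: abs_le_iff)
      qed
      ultimately show "x \<in> ?N"
        by (intro UN_I[of y] UN_I[of "x - y"]) auto
    qed
    then show ?thesis unfolding K1_def by blast
  qed
  show "closed K1"
    unfolding eq
  proof (intro closed_Int)
    show "closed unit_cube" by (simp add: compact_imp_closed compact_unit_cube)
    show "closed (\<Union>T\<in>{T. card T = k}. \<Inter>i\<in>T. (\<lambda>x. x $ i / h) -` \<int>)"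
      using h(1) by (intro closed_UN closed_INT ballI closed_vimage closed_Ints continuous_intros) auto
    show "closed ?N" by (rule compact_imp_closed[OF compact_sums'[OF K(1) compact_cbox]])
  qed
  show "hits_flats k K1"
    unfolding hits_flats_def
  proof (intro allI impI, elim conjE)
    fix A :: "(real ^ 'n) set"
    assume A: "affine A" "aff_dim A = int k" "A \<inter> unit_cube \<noteq> {}"
    then obtain y where y: "y \<in> K" "y \<in> A" using K(3) unfolding hits_flats_def by blast
    then have y01: "0 \<le> y $ i" "y $ i \<le> 1" for i using K(2) by (auto simp: mem_unit_cube)
    define a where "a = (\<chi> i. h * of_int \<lfloor>y $ i / h\<rfloor>)"
    \<comment> \<open>The minimum takes effect only for \<open>y $ i = 1\<close>; the cell is then
      degenerate in that coordinate.\<close>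
    define b where "b = (\<chi> i. min 1 (a $ i + h))"
    have ay: "a $ i \<le> y $ i" "y $ i \<le> a $ i + h" and a0: "0 \<le> a $ i" for i
      using floor_lattice_bounds[OF h(1), of "y $ i"] h(1) y01[of i] by (simp_all add: a_def)
    have aZ: "a $ i / h \<in> \<int>" for i using h(1) by (simp add: a_def)
    have bZ: "b $ i / h \<in> \<int>" for i
    proof (cases "1 \<le> a $ i + h")
      case False
      moreover have "(a $ i + h) / h \<in> \<int>"
        using aZ[of i] h(1) by (simp add: add_divide_distrib)
      ultimately show ?thesis by (simp add: b_def)
    qed (use h(2) in \<open>simp add: b_def\<close>)
    have "y \<in> cbox a b" using ay y01 by (simp add: mem_box_cart b_def)
    with y A(1) obtain x where x: "x extreme_point_of (A \<inter> cbox a b)"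
      using affine_box_extreme_exists by blast
    then have xA: "x \<in> A" and x_box: "a $ i \<le> x $ i" "x $ i \<le> b $ i" for i
      by (auto simp: extreme_point_of_def mem_box_cart)
    have "k \<le> card {i. x $ i = a $ i \<or> x $ i = b $ i}"
      by (rule extreme_point_box_card[OF A(1,2) x])
    then obtain T where "T \<subseteq> {i. x $ i = a $ i \<or> x $ i = b $ i}" "card T = k"
      by (meson obtain_subset_with_card_n)
    then have "card T = k \<and> (\<forall>i\<in>T. x $ i / h \<in> \<int>)" using aZ bZ by force
    moreover have "x \<in> unit_cube"
      unfolding mem_unit_cube
    proof
      fix i show "0 \<le> x $ i \<and> x $ i \<le> 1"
        using a0[of i] x_box[of i] by (auto simp: b_def)
    qed
    moreover have "\<bar>x $ i - y $ i\<bar> \<le> h" for i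
      using x_box[of i] ay[of i] by (auto simp: b_def)
    ultimately have "x \<in> K1" using y(1) unfolding K1_def by blast
    with xA show "K1 \<inter> A \<noteq> {}" by blast
  qed
qed

section \<open>Replacing all crossings of a skeleton with its reflection\<close>

text \<open>\<open>K'\<close> is the grid skeleton near \<open>K\<close> outside open boxes around
  the crossings, together with the gadget pieces in those boxes. Fullness is checked box by box, and
  \<open>z \<notin> K' + K'\<close> by comparing the kinds of pieces pairwise.\<close>

lemma perturb_avoiding_sum:
  fixes K W :: "(real ^ 'n) set"
  assumes K: "compact K" "K \<subseteq> unit_cube" "hits_flats k K"
    and k: "0 < k" "CARD('n) \<le> 2 * k" and "0 < e" and W: "open W" "W \<noteq> {}"
  obtains K' z where "compact K'" "K' \<subseteq> unit_cube" "hits_flats k K'"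
    "\<And>x. x \<in> K' \<Longrightarrow> \<exists>y\<in>K. dist x y < e" "z \<in> W" "z \<notin> K' + K'"
proof -
  obtain z0 r where z0: "0 < r" "ball z0 r \<subseteq> W"
    using W by (metis all_not_in_conv open_contains_ball)
  define m where "m = min e r"
  have m: "0 < m" "m \<le> e" "m \<le> r" using \<open>0 < e\<close> z0(1) by (auto simp: m_def)
  obtain N :: nat where N0: "real CARD('n) * 2 / m < real N"
    using reals_Archimedean2 by blast
  have "0 \<le> real CARD('n) * 2 / m" using m(1) by simp
  then have "0 < real N" using N0 by linarith
  then have N: "N > 0" "real CARD('n) * 2 / real N < m"
    using m(1) N0 by (simp_all add: field_simps)
  define \<eta> where "\<eta> = 1 / (18 * real N)"
  have \<eta>: "0 < \<eta>" "16 * \<eta> \<le> 1" using N(1) by (auto simp: \<eta>_def field_simps)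
  \<comment> \<open>The 22 is 18 + 4: one mesh between the skeleton and \<open>K\<close>, and the
    larger radius of a gadget.\<close>
  have small: "real CARD('n) * (22 * \<eta>) < m"
  proof -
    have "real CARD('n) * (22 * \<eta>) \<le> real CARD('n) * (2 / real N)"
      using N(1) by (intro mult_left_mono) (auto simp: \<eta>_def field_simps)
    then show ?thesis using N(2) by simp
  qed
  \<comment> \<open>\<open>G\<close> marks the grid values and \<open>M\<close> the half-grid
    values.\<close>
  define G where "G t \<longleftrightarrow> t / (18 * \<eta>) \<in> \<int>" for t
  define M where "M t \<longleftrightarrow> t / (9 * \<eta>) \<in> \<int>" for t
  have G01: "G 0" "G 1" by (auto simp: G_def \<eta>_def)
  have G_M: "M t" if "G t" for t
  proof -
    have "2 * (t / (18 * \<eta>)) \<in> \<int>" using that unfolding G_def by (intro Ints_mult) auto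
    moreover have "2 * (t / (18 * \<eta>)) = t / (9 * \<eta>)" using \<eta>(1) by (simp add: field_simps)
    ultimately show ?thesis by (simp only: M_def)
  qed
  have M_add: "M (s + t)" and M_diff: "M (s - t)" if "M s" "M t" for s t
    using that by (auto simp: M_def add_divide_distrib diff_divide_distrib)
  \<comment> \<open>Half the mesh exceeds the sum of any two gadget radii, so this turns approximate
    coincidences into equalities.\<close>
  have M_small: "s = t" if "M s" "M t" "\<bar>s - t\<bar> < 9 * \<eta>" for s t
  proof -
    have "(s - t) / (9 * \<eta>) \<in> \<int>" using M_diff[OF that(1,2)] by (simp add: M_def)
    moreover have "\<bar>(s - t) / (9 * \<eta>)\<bar> < 1" using that(3) \<eta>(1) by (simp add: abs_divide)
    ultimately have "(s - t) / (9 * \<eta>) = 0" by (meson Ints_nonzero_abs_less1)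
    then show ?thesis using \<eta>(1) by simp
  qed
  \<comment> \<open>The ends 0 and 1 are grid values, so other half-grid values keep away from them.
    This supplies \<open>pI\<close> and \<open>qJ\<close> of the gadget.\<close>
  have inner: "4 * \<eta> \<le> t \<and> t \<le> 1 - 4 * \<eta>" if "M t" "\<not> G t" "0 \<le> t" "t \<le> 1" for t
  proof (rule ccontr)
    assume "\<not> ?thesis"
    then have "\<bar>t - 0\<bar> < 9 * \<eta> \<or> \<bar>t - 1\<bar> < 9 * \<eta>" using that \<eta>(1) by linarith
    then have "t = 0 \<or> t = 1" using M_small that(1) G01 G_M by blast
    then show False using that(2) G01 by blast
  qed
  \<comment> \<open>The grid has mesh \<open>18 \<eta>\<close>; every coordinate of \<open>z\<close> is an odd multiple of half the mesh, so
    crossings lie on the half grid and boxes of radius \<open>4 \<eta>\<close> around distinct ones are disjoint.\<close>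
  define z where "z = (\<chi> i. 18 * \<eta> * of_int \<lfloor>z0 $ i / (18 * \<eta>)\<rfloor> + 9 * \<eta>)"
  have zM: "M (z $ i)" for i
  proof -
    have "G (18 * \<eta> * of_int \<lfloor>z0 $ i / (18 * \<eta>)\<rfloor>)" "M (9 * \<eta>)"
      using \<eta>(1) by (simp_all add: G_def M_def)
    then show ?thesis unfolding z_def using M_add G_M by simp
  qed
  \<comment> \<open>Two grid values add up to an even multiple of \<open>9 * \<eta>\<close>, while
    \<open>z $ i\<close> is an odd one.\<close>
  have zG: "\<not> (G t \<and> G (z $ i - t))" for t i
  proof
    assume "G t \<and> G (z $ i - t)"
    then have "t / (18 * \<eta>) + (z $ i - t) / (18 * \<eta>) \<in> \<int>"
      unfolding G_def by (blast intro: Ints_add)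
    moreover define n where "n = \<lfloor>z0 $ i / (18 * \<eta>)\<rfloor>"
    moreover have "z $ i = 18 * \<eta> * of_int n + 9 * \<eta>" by (simp add: z_def n_def)
    then have "t / (18 * \<eta>) + (z $ i - t) / (18 * \<eta>) = of_int n + 1 / 2"
      unfolding add_divide_distrib[symmetric] using \<eta>(1) by (simp add: field_simps)
    ultimately have "of_int n + 1 / 2 \<in> (\<int> :: real set)" by simp
    then have "of_int n + 1 / 2 - of_int n \<in> (\<int> :: real set)" by (intro Ints_diff) auto
    then have "1 / 2 \<in> (\<int> :: real set)" by simp
    then show False using Ints_nonzero_abs_less1[of "1 / 2 :: real"] by simp
  qed
  have "z \<in> W"
  proof -
    have "\<bar>z $ i - z0 $ i\<bar> \<le> 22 * \<eta>" for i
      using floor_lattice_bounds[of "18 * \<eta>" "z0 $ i"] \<eta>(1) unfolding z_def by (simp add: abs_le_iff)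
    from dist_le_CARD_times[OF this] small m(3) have "dist z0 z < r" by (simp add: dist_commute)
    then show ?thesis using z0(2) by auto
  qed
  define K1 where "K1 = {x \<in> unit_cube. (\<exists>T. card T = k \<and> (\<forall>i\<in>T. x $ i / (18 * \<eta>) \<in> \<int>)) \<and>
    (\<exists>y\<in>K. \<forall>i. \<bar>x $ i - y $ i\<bar> \<le> 18 * \<eta>)}"
  have h: "0 < 18 * \<eta>" "1 / (18 * \<eta>) \<in> \<int>" using \<eta>(1) by (simp_all add: \<eta>_def)
  note K1 = lattice_skeleton[OF K h, folded K1_def]
  have K1_cube: "x \<in> unit_cube" if "x \<in> K1" for x using that by (simp add: K1_def)
  have K1_near: "\<exists>y\<in>K. \<forall>i. \<bar>x $ i - y $ i\<bar> \<le> 18 * \<eta>" if "x \<in> K1" for x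
    using that unfolding K1_def by blast
  have K1_G: "\<exists>T. card T = k \<and> T \<subseteq> {i. G (x $ i)}" if "x \<in> K1" for x
    using that unfolding K1_def G_def by blast
  have K1_card: "k \<le> card {i. G (x $ i)}" if "x \<in> K1" for x
    using K1_G[OF that] by (metis card_mono finite)
  define J where "J p = {i. G (p $ i)}" for p :: "real ^ 'n"
  define B where "B = {p \<in> K1. z - p \<in> K1}"
  \<comment> \<open>By \<open>zG\<close> the grid coordinates of \<open>p\<close> and of
    \<open>z - p\<close> are disjoint sets of at least \<open>k\<close> elements each. Since
    \<open>CARD('n) \<le> 2 * k\<close>, they have exactly \<open>k\<close> and are
    complementary.\<close>
  have BJ: "card (J p) = k" "card (- J p) = k" "\<And>i. i \<notin> J p \<Longrightarrow> G (z $ i - p $ i)" if "p \<in> B" for p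
  proof -
    let ?I = "{i. G ((z - p) $ i)}"
    have sub: "?I \<subseteq> - J p" using zG by (auto simp: J_def)
    have "k \<le> card (J p)"
      using K1_card[of p] that by (simp add: B_def J_def)
    moreover have I: "k \<le> card ?I"
      using K1_card[of "z - p"] that by (simp add: B_def)
    moreover have "card ?I \<le> card (- J p)" using sub by (intro card_mono) auto
    moreover have "card (J p) + card (- J p) = CARD('n)"
      by (subst card_Un_disjoint[symmetric]) auto
    ultimately show "card (J p) = k" and cI: "card (- J p) = k" using k by linarith+
    have "?I = - J p" using sub I cI by (intro card_seteq) auto
    then show "G (z $ i - p $ i)" if "i \<notin> J p" for i using that by auto
  qed
  have BM: "M (p $ i)" if "p \<in> B" for p i
  proof (cases "i \<in> J p")
    case False
    then have "M (z $ i - (z $ i - p $ i))" using BJ(3)[OF that] G_M M_diff zM by blast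
    then show ?thesis by simp
  qed (use G_M in \<open>auto simp: J_def\<close>)
  \<comment> \<open>Crossings come in pairs \<open>p\<close>, \<open>z - p\<close>; the set \<open>P\<close> contains one of each pair.\<close>
  define c :: 'n where "c = undefined"
  define P where "P = {p \<in> B. p $ c < z $ c / 2}"
  have PB: "p \<in> B" if "p \<in> P" for p using that by (simp add: P_def)
  \<comment> \<open>Equality would make \<open>p $ c\<close> and \<open>z $ c - p $ c\<close> equal,
    but exactly one of them is a grid value.\<close>
  have B_half: "p $ c \<noteq> z $ c / 2" if "p \<in> B" for p
  proof
    assume "p $ c = z $ c / 2"
    then have "z $ c - p $ c = p $ c" by simp
    then show False using BJ(3)[OF that, of c] zG[of "p $ c" c] by (auto simp: J_def)
  qed
  have B_cases: "p \<in> P \<or> z - p \<in> P" if "p \<in> B" for p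
    using that B_half[OF that] by (auto simp: P_def B_def)
  have "B \<subseteq> {p. p \<in> unit_cube \<and> (\<forall>i. p $ i / (9 * \<eta>) \<in> \<int>)}"
  proof
    fix p assume "p \<in> B"
    then show "p \<in> {p. p \<in> unit_cube \<and> (\<forall>i. p $ i / (9 * \<eta>) \<in> \<int>)}"
      using BM[of p] K1_cube[of p] unfolding M_def B_def by blast
  qed
  then have "finite B"
    by (rule finite_subset) (rule finite_lattice_unit_cube, use \<eta>(1) in simp)
  then have finP: "finite P" by (simp add: P_def)
  \<comment> \<open>\<open>Q\<close> bundles the properties of a gadget so that the pieces for all
    crossings can be chosen at once.\<close>
  define Q where "Q p F F' \<longleftrightarrow> closed F \<and> closed F' \<and>
    (\<forall>x. x \<in> F \<longrightarrow> x \<in> unit_cube \<and> (\<forall>i. \<bar>x $ i - p $ i\<bar> \<le> 4 * \<eta>)) \<and>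
    (\<forall>x. x \<in> F' \<longrightarrow> x \<in> unit_cube \<and> (\<forall>i. \<bar>x $ i - (z - p) $ i\<bar> \<le> 3 * \<eta>)) \<and>
    (\<forall>A x. affine A \<longrightarrow> aff_dim A = int k \<longrightarrow> x \<in> A \<longrightarrow> x \<in> unit_cube \<longrightarrow>
      (\<forall>i. \<bar>x $ i - p $ i\<bar> \<le> 4 * \<eta>) \<longrightarrow> A \<inter> F \<noteq> {}) \<and>
    (\<forall>A x. affine A \<longrightarrow> aff_dim A = int k \<longrightarrow> x \<in> A \<longrightarrow> x \<in> unit_cube \<longrightarrow>
      (\<forall>i. \<bar>x $ i - (z - p) $ i\<bar> \<le> 3 * \<eta>) \<longrightarrow> A \<inter> F' \<noteq> {}) \<and>
    (\<forall>x. x \<in> F \<longrightarrow> z - x \<notin> F') \<and>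
    (\<forall>x i. x \<in> F \<longrightarrow> (\<forall>j. j \<notin> J p \<longrightarrow> x $ j = p $ j) \<longrightarrow> \<bar>x $ i - p $ i\<bar> < 3 * \<eta>)"
    for p F F'
  have "\<exists>F F'. Q p F F'" if "p \<in> P" for p
  proof -
    have pB: "p \<in> B" by (rule PB[OF that])
    have cube: "p \<in> unit_cube" "z - p \<in> unit_cube" using pB K1_cube by (auto simp: B_def)
    have pI: "4 * \<eta> \<le> p $ i \<and> p $ i \<le> 1 - 4 * \<eta>" if "i \<notin> J p" for i
      using inner[of "p $ i"] BM[OF pB, of i] that cube(1) by (simp add: J_def mem_unit_cube)
    have qJ: "4 * \<eta> \<le> z $ i - p $ i \<and> z $ i - p $ i \<le> 1 - 4 * \<eta>" if "i \<in> J p" for i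
      using inner[of "z $ i - p $ i"] M_diff[OF zM BM[OF pB]] zG[of "p $ i" i] that cube(2)
      by (simp add: J_def mem_unit_cube)
    show ?thesis
      by (rule crossing_gadget[OF \<eta> cube BJ(1,2)[OF pB] k(1) pI qJ])
        (assumption | (unfold Q_def, blast))+
  qed
  then obtain F F' where FQ: "\<And>p. p \<in> P \<Longrightarrow> Q p (F p) (F' p)" by metis
  have F_closed: "closed (F p)" "closed (F' p)"
    and F_cube: "x \<in> F p \<Longrightarrow> x \<in> unit_cube" "x \<in> F' p \<Longrightarrow> x \<in> unit_cube"
    and F_near: "x \<in> F p \<Longrightarrow> \<bar>x $ i - p $ i\<bar> \<le> 4 * \<eta>"
    and F'_near: "x \<in> F' p \<Longrightarrow> \<bar>x $ i - (z $ i - p $ i)\<bar> \<le> 3 * \<eta>"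
    and F_disj: "x \<in> F p \<Longrightarrow> z - x \<notin> F' p"
    and F_axis: "x \<in> F p \<Longrightarrow> \<forall>j. j \<notin> J p \<longrightarrow> x $ j = p $ j \<Longrightarrow> \<bar>x $ i - p $ i\<bar> < 3 * \<eta>"
    if "p \<in> P" for p x i
    using FQ[OF that] unfolding Q_def by auto
  have F_hit: "A \<inter> F p \<noteq> {}"
    if "p \<in> P" "affine A" "aff_dim A = int k" "x \<in> A" "x \<in> unit_cube"
      "\<And>i. \<bar>x $ i - p $ i\<bar> \<le> 4 * \<eta>" for p A x
    using FQ[OF that(1)] that(2-) unfolding Q_def by blast
  have F'_hit: "A \<inter> F' p \<noteq> {}"
    if "p \<in> P" "affine A" "aff_dim A = int k" "x \<in> A" "x \<in> unit_cube"
      "\<And>i. \<bar>x $ i - (z - p) $ i\<bar> \<le> 3 * \<eta>" for p A x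
    using FQ[OF that(1)] that(2-) unfolding Q_def by blast
  \<comment> \<open>Only open boxes are removed, which keeps \<open>R\<close> closed; the gadgets
    also block flats through boundary points.\<close>
  define U where "U p = {x. \<forall>i. \<bar>x $ i - p $ i\<bar> < 4 * \<eta>}" for p :: "real ^ 'n"
  define U' where "U' p = {x. \<forall>i. \<bar>x $ i - (z - p) $ i\<bar> < 3 * \<eta>}" for p
  have U_open: "open (U p)" "open (U' p)" for p
    unfolding U_def U'_def by (rule open_sup_ball)+
  define R where "R = K1 - (\<Union>p\<in>P. U p \<union> U' p)"
  define K' where "K' = R \<union> (\<Union>p\<in>P. F p \<union> F' p)"
  show ?thesis
  proof (rule that[of K' z])
    show K'_cube: "K' \<subseteq> unit_cube"
      using F_cube K1_cube by (auto simp: K'_def R_def)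
    have "closed R"
      unfolding R_def by (intro closed_Diff K1 open_UN ballI open_Un U_open)
    then have "closed K'"
      unfolding K'_def by (intro closed_Un closed_UN finP ballI F_closed)
    then show "compact K'"
      using K'_cube compact_unit_cube by (metis compact_Int_closed inf.absorb2)
    show "hits_flats k K'"
      unfolding hits_flats_def
    proof (intro allI impI, elim conjE)
      fix A :: "(real ^ 'n) set"
      assume A: "affine A" "aff_dim A = int k" "A \<inter> unit_cube \<noteq> {}"
      then obtain x where x: "x \<in> K1" "x \<in> A" using K1(2) unfolding hits_flats_def by blast
      note xc = K1_cube[OF x(1)]
      consider p where "p \<in> P" "x \<in> U p" | p where "p \<in> P" "x \<in> U' p" | "x \<in> R"
        using x(1) by (auto simp: R_def)
      then show "K' \<inter> A \<noteq> {}"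
      proof cases
        case (1 p)
        then have "A \<inter> F p \<noteq> {}"
          using F_hit[OF _ A(1,2) x(2) xc] by (auto simp: U_def less_imp_le)
        then show ?thesis using 1(1) unfolding K'_def by blast
      next
        case (2 p)
        then have "A \<inter> F' p \<noteq> {}"
          using F'_hit[OF _ A(1,2) x(2) xc] by (auto simp: U'_def less_imp_le)
        then show ?thesis using 2(1) unfolding K'_def by blast
      next
        case 3
        then show ?thesis using x(2) unfolding K'_def by blast
      qed
    qed
    show "\<exists>y\<in>K. dist x y < e" if xK': "x \<in> K'" for x
    proof -
      have "\<exists>y\<in>K1. \<forall>i. \<bar>x $ i - y $ i\<bar> \<le> 4 * \<eta>"
      proof -
        consider "x \<in> K1" | p where "p \<in> P" "x \<in> F p" | p where "p \<in> P" "x \<in> F' p"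
          using xK' by (auto simp: K'_def R_def)
        then show ?thesis
        proof cases
          case 1
          then show ?thesis using \<eta>(1) by (intro bexI[of _ x]) auto
        next
          case (2 p)
          then show ?thesis using F_near PB by (intro bexI[of _ p]) (auto simp: B_def)
        next
          case (3 p)
          then have "\<bar>x $ i - (z - p) $ i\<bar> \<le> 4 * \<eta>" for i
            using F'_near[OF 3, of i] \<eta>(1) by simp
          then show ?thesis using 3 PB by (intro bexI[of _ "z - p"]) (auto simp: B_def)
        qed
      qed
      then obtain v y where vy: "\<And>i. \<bar>x $ i - v $ i\<bar> \<le> 4 * \<eta>" "\<And>i. \<bar>v $ i - y $ i\<bar> \<le> 18 * \<eta>" "y \<in> K"
        using K1_near by blast
      have "\<bar>x $ i - y $ i\<bar> \<le> 22 * \<eta>" for i using vy(1,2)[of i] by linarith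
      from dist_le_CARD_times[OF this] small m(2) vy(3) show ?thesis by force
    qed
    show "z \<in> W" by fact
    \<comment> \<open>Such an \<open>x\<close> would be a crossing, but then \<open>x\<close> or
      \<open>z - x\<close> is the centre of a removed box.\<close>
    have RR: "z - x \<notin> R" if "x \<in> R" for x
    proof
      assume "z - x \<in> R"
      with that have "x \<in> B" by (simp add: R_def B_def)
      then consider "x \<in> P" | "z - x \<in> P" using B_cases by blast
      then show False
      proof cases
        case 1
        moreover have "x \<in> U x" using \<eta>(1) by (simp add: U_def)
        ultimately show ?thesis using \<open>x \<in> R\<close> by (auto simp: R_def)
      next
        case 2
        moreover have "z - x \<in> U (z - x)" using \<eta>(1) by (simp add: U_def)
        ultimately show ?thesis using \<open>z - x \<in> R\<close> by (auto simp: R_def)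
      qed
    qed
    \<comment> \<open>The \<open>k\<close> grid coordinates of \<open>z - x\<close> must agree with
      those of \<open>z - p\<close>, so \<open>x\<close> agrees with \<open>p\<close> outside
      \<open>J p\<close>. By \<open>F_axis\<close>, \<open>z - x\<close> then lies in the smaller
      removed box \<open>U' p\<close>.\<close>
    have FR: "z - x \<notin> R" if "p \<in> P" "x \<in> F p" for p x
    proof
      assume zx: "z - x \<in> R"
      note pB = PB[OF that(1)]
      obtain T where T: "card T = k" "T \<subseteq> {i. G ((z - x) $ i)}"
        using K1_G[of "z - x"] zx by (auto simp: R_def)
      have eq: "x $ i = p $ i" if "i \<in> T" for i
      proof -
        have "z $ i - x $ i = z $ i - p $ i"
        proof (rule M_small)
          show "M (z $ i - x $ i)" using T(2) that G_M by auto
          show "M (z $ i - p $ i)" by (rule M_diff[OF zM BM[OF pB]])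
          show "\<bar>z $ i - x $ i - (z $ i - p $ i)\<bar> < 9 * \<eta>"
            using F_near[OF \<open>p \<in> P\<close> \<open>x \<in> F p\<close>, of i] \<eta>(1) by linarith
        qed
        then show ?thesis by simp
      qed
      have "T \<subseteq> - J p"
        using T(2) eq zG by (auto simp: J_def)
      then have "T = - J p"
        using T(1) BJ(2)[OF pB] by (intro card_seteq) auto
      then have "\<bar>x $ i - p $ i\<bar> < 3 * \<eta>" for i
        using eq by (intro F_axis[OF that]) auto
      then have "z - x \<in> U' p" by (simp add: U'_def abs_minus_commute)
      then show False using zx that(1) by (auto simp: R_def)
    qed
    have F'R: "z - x \<notin> R" if "p \<in> P" "x \<in> F' p" for p x
    proof
      assume zx: "z - x \<in> R"
      have "\<bar>(z - x) $ i - p $ i\<bar> < 4 * \<eta>" for i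
        using F'_near[OF that, of i] \<eta>(1) unfolding vector_minus_component by linarith
      then have "z - x \<in> U p" by (simp add: U_def)
      then show False using zx that(1) by (auto simp: R_def)
    qed
    \<comment> \<open>Closeness forces \<open>p $ c + p' $ c = z $ c\<close>, although both summands
      are below half of it by the choice of \<open>P\<close>.\<close>
    have FF: "z - x \<notin> F p'" if "p \<in> P" "x \<in> F p" "p' \<in> P" for p p' x
    proof
      assume zx: "z - x \<in> F p'"
      have "p $ c + p' $ c = z $ c"
      proof (rule M_small)
        show "M (p $ c + p' $ c)" "M (z $ c)" using BM PB that M_add zM by auto
        show "\<bar>p $ c + p' $ c - z $ c\<bar> < 9 * \<eta>"
          using F_near[OF that(1,2), of c] F_near[OF that(3) zx, of c] \<eta>(1)
          unfolding vector_minus_component by linarith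
      qed
      then show False using that by (simp add: P_def)
    qed
    have F'F': "z - x \<notin> F' p'" if "p \<in> P" "x \<in> F' p" "p' \<in> P" for p p' x
    proof
      assume zx: "z - x \<in> F' p'"
      have "p $ c + p' $ c = z $ c"
      proof (rule M_small)
        show "M (p $ c + p' $ c)" "M (z $ c)" using BM PB that M_add zM by auto
        show "\<bar>p $ c + p' $ c - z $ c\<bar> < 9 * \<eta>"
          using F'_near[OF that(1,2), of c] F'_near[OF that(3) zx, of c] \<eta>(1)
          unfolding vector_minus_component by linarith
      qed
      then show False using that by (simp add: P_def)
    qed
    have FF': "z - x \<notin> F' p'" if "p \<in> P" "x \<in> F p" "p' \<in> P" for p p' x
    proof
      assume zx: "z - x \<in> F' p'"
      have "p $ i = p' $ i" for i
      proof (rule M_small)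
        show "M (p $ i)" "M (p' $ i)" using BM PB that by auto
        show "\<bar>p $ i - p' $ i\<bar> < 9 * \<eta>"
          using F_near[OF that(1,2), of i] F'_near[OF that(3) zx, of i] \<eta>(1)
          unfolding vector_minus_component by linarith
      qed
      then have "p = p'" by (simp add: vec_eq_iff)
      then show False using F_disj that zx by blast
    qed
    have "z - x \<notin> K'" if "x \<in> K'" for x
    proof
      assume zx: "z - x \<in> K'"
      have swap: "z - (z - x) = x" by simp
      consider "x \<in> R" | p where "p \<in> P" "x \<in> F p" | p where "p \<in> P" "x \<in> F' p"
        using \<open>x \<in> K'\<close> unfolding K'_def by blast
      note x_cases = this
      consider "z - x \<in> R" | p where "p \<in> P" "z - x \<in> F p" | p where "p \<in> P" "z - x \<in> F' p"
        using zx unfolding K'_def by blast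
      \<comment> \<open>The remaining combinations follow by exchanging \<open>x\<close> and
        \<open>z - x\<close>.\<close>
      then show False
        using x_cases RR FR F'R FF F'F' FF' swap by cases metis+
    qed
    then show "z \<notin> K' + K'"
      by (force simp: set_plus_def)
  qed
qed

section \<open>The limit set\<close>

lemma unit_cube_hits_flats: "hits_flats k unit_cube"
  by (auto simp: hits_flats_def)

text \<open>\<open>K' + K'\<close> is compact, so \<open>z\<close> has a positive distance
  \<open>s\<close> from it. Thickening both summands by at most \<open>s / 3\<close> still misses
  \<open>z\<close>, so the property passes to a closed neighbourhood and to all its subsets.\<close>

lemma hits_flats_shrink:
  fixes V W :: "(real ^ 'n) set"
  assumes k: "0 < k" "CARD('n) \<le> 2 * k" and W: "open W" "W \<noteq> {}"
    and K: "compact K" "K \<subseteq> unit_cube" "hits_flats k K" "K \<subseteq> interior V"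
  obtains V' K' z where "closed V'" "V' \<subseteq> V" "compact K'" "K' \<subseteq> unit_cube" "hits_flats k K'"
    "K' \<subseteq> interior V'" "z \<in> W" "z \<notin> V' + V'"
proof -
  obtain e where e: "e > 0" "(\<Union>x\<in>K. cball x e) \<subseteq> interior V"
    using compact_subset_open_imp_cball_epsilon_subset[OF K(1) open_interior K(4)] by blast
  obtain K' z where K': "compact K'" "K' \<subseteq> unit_cube" "hits_flats k K'"
    and near: "\<And>x. x \<in> K' \<Longrightarrow> \<exists>y\<in>K. dist x y < e / 2" and z: "z \<in> W" "z \<notin> K' + K'"
    using perturb_avoiding_sum[OF K(1-3) k _ W, of "e / 2"] e(1) by (metis half_gt_zero)
  have "K' + K' = {x + y |x y. x \<in> K' \<and> y \<in> K'}" by (auto simp: set_plus_def)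
  then have "closed (K' + K')" using compact_sums[OF K'(1,1)] compact_imp_closed by simp
  then obtain s where s: "s > 0" "\<And>x. x \<in> K' + K' \<Longrightarrow> s \<le> dist z x"
    using separate_point_closed z(2) by metis
  define r where "r = min (e / 2) (s / 3)"
  have r: "r > 0" "r \<le> e / 2" "r \<le> s / 3" using e(1) s(1) by (auto simp: r_def)
  define V' where "V' = (\<Union>x\<in>K'. \<Union>y\<in>cball 0 r. {x + y})"
  show ?thesis
  proof (rule that[OF _ _ K' _ z(1)])
    show "closed V'"
      unfolding V'_def by (rule compact_imp_closed[OF compact_sums'[OF K'(1) compact_cball]])
    show "V' \<subseteq> V"
    proof
      fix v assume "v \<in> V'"
      then obtain x y where xy: "x \<in> K'" "norm y \<le> r" "v = x + y" by (auto simp: V'_def)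
      obtain u where u: "u \<in> K" "dist x u < e / 2" using near[OF xy(1)] by blast
      have "dist u v \<le> dist u x + dist x v" by (rule dist_triangle)
      also have "\<dots> \<le> e" using u(2) xy r(2) by (simp add: dist_commute dist_norm)
      finally have "v \<in> cball u e" by simp
      then show "v \<in> V" using e(2) u(1) interior_subset by blast
    qed
    show "K' \<subseteq> interior V'"
    proof
      fix x assume x: "x \<in> K'"
      have "ball x r \<subseteq> V'"
      proof
        fix v assume "v \<in> ball x r"
        then show "v \<in> V'"
          unfolding V'_def using x
          by (intro UN_I[of x] UN_I[of "v - x"]) (auto simp: dist_norm norm_minus_commute)
      qed
      then show "x \<in> interior V'"
        using r(1) unfolding mem_interior by blast
    qed
    show "z \<notin> V' + V'"
    proof
      assume "z \<in> V' + V'"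
      then obtain x y x' y' where *: "x \<in> K'" "norm y \<le> r" "x' \<in> K'" "norm y' \<le> r"
        "z = (x + y) + (x' + y')"
        by (auto simp: V'_def set_plus_def)
      have "s \<le> dist z (x + x')" using s(2) * by blast
      also have "\<dots> = norm (y + y')" using * by (simp add: dist_norm algebra_simps)
      also have "\<dots> \<le> norm y + norm y'" by (rule norm_triangle_ineq)
      also have "\<dots> < s" using * r(3) s(1) by linarith
      finally show False by simp
    qed
  qed
qed

theorem theorem6p1:
  fixes d k :: nat
  assumes "CARD('n::finite) = d"
    and "d \<ge> 2"
    and "k < d"
    and "real k \<ge> real d / 2"
  shows "\<exists>K :: (real ^ 'n) set.
    compact K \<and> K \<subseteq> unit_cube \<and>
    (\<forall>A. affine A \<and> aff_dim A = int k \<and> A \<inter> unit_cube \<noteq> {} \<longrightarrow> K \<inter> A \<noteq> {}) \<and>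
    nowhere_dense (K + K)"
proof -
  have k: "0 < k" "CARD('n) \<le> 2 * k" using assms by linarith+
  obtain \<B> :: "(real ^ 'n) set set" where \<B>: "countable \<B>" "topological_basis \<B>"
    using ex_countable_basis by blast
  have "\<B> \<noteq> {}"
    using topological_basisE[OF \<B>(2) open_UNIV, of 0] by blast
  define W where "W = from_nat_into \<B>"
  have "W n \<in> \<B>" for n unfolding W_def by (rule from_nat_into[OF \<open>\<B> \<noteq> {}\<close>])
  then have W: "open (W n)" for n using topological_basis_open[OF \<B>(2)] by blast
  \<comment> \<open>The recursion carries closed neighbourhoods of full sets; a sum avoided at one
    stage stays avoided in all smaller sets.\<close>
  define good where "good V \<longleftrightarrow> closed V \<and>
    (\<exists>K. compact K \<and> K \<subseteq> unit_cube \<and> hits_flats k K \<and> K \<subseteq> interior V)" for V :: "(real ^ 'n) set"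
  have "\<exists>V. \<forall>n. good (V n) \<and> (V (Suc n) \<subseteq> V n \<and> (W n \<noteq> {} \<longrightarrow> \<not> W n \<subseteq> V (Suc n) + V (Suc n)))"
  proof (rule dependent_nat_choice)
    show "\<exists>V. good V"
      unfolding good_def
      by (intro exI[of _ UNIV] exI[of _ unit_cube] conjI) (auto simp: compact_unit_cube unit_cube_hits_flats)
    show "\<exists>V'. good V' \<and> (V' \<subseteq> V \<and> (W n \<noteq> {} \<longrightarrow> \<not> W n \<subseteq> V' + V'))" if gV: "good V" for V n
    \<comment> \<open>A basis may contain the empty set; at such an index the neighbourhood is kept
      unchanged.\<close>
    proof (cases "W n = {}")
      case False
      obtain K where K: "compact K" "K \<subseteq> unit_cube" "hits_flats k K" "K \<subseteq> interior V"
        using gV unfolding good_def by blast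
      show ?thesis
        by (rule hits_flats_shrink[OF k W False K]) (unfold good_def, blast)
    qed (use gV in blast)
  qed
  then obtain V where good: "\<And>n. good (V n)" and dec: "\<And>n. V (Suc n) \<subseteq> V n"
    and avoid: "\<And>n. W n \<noteq> {} \<Longrightarrow> \<not> W n \<subseteq> V (Suc n) + V (Suc n)"
    by blast
  have anti: "V n \<subseteq> V m" if "m \<le> n" for m n
    using that dec by (rule lift_Suc_antimono_le[rotated])
  define K where "K = unit_cube \<inter> \<Inter>(range V)"
  have "closed (\<Inter>(range V))" using good unfolding good_def by blast
  then have "compact K" unfolding K_def by (rule compact_Int_closed[OF compact_unit_cube])
  moreover have "K \<subseteq> unit_cube" by (simp add: K_def)
  moreover have "K \<inter> A \<noteq> {}" if A: "affine A" "aff_dim A = int k" "A \<inter> unit_cube \<noteq> {}" for A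
  proof -
    \<comment> \<open>Each \<open>V n\<close> contains a full set, so its sections by
      \<open>A\<close> in the cube are nonempty, compact and nested.\<close>
    have "\<Inter>(range (\<lambda>n. unit_cube \<inter> A \<inter> V n)) \<noteq> {}"
    proof (rule compact_nest)
      fix n
      show "compact (unit_cube \<inter> A \<inter> V n)"
        using good[of n] affine_closed[OF A(1)] compact_unit_cube
        unfolding good_def by (intro compact_Int_closed) auto
      obtain K' where "K' \<subseteq> unit_cube" "hits_flats k K'" "K' \<subseteq> V n"
        using good[of n] interior_subset unfolding good_def by blast
      then show "unit_cube \<inter> A \<inter> V n \<noteq> {}" using A unfolding hits_flats_def by blast
    qed (use anti in blast)
    then show ?thesis unfolding K_def by blast
  qed
  moreover have "nowhere_dense (K + K)"
  proof -
    \<comment> \<open>Since \<open>K + K\<close> is closed, it remains to show that its interior is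
      empty.\<close>
    have "K + K = {x + y |x y. x \<in> K \<and> y \<in> K}" by (auto simp: set_plus_def)
    then have "closed (K + K)"
      using compact_sums[OF \<open>compact K\<close> \<open>compact K\<close>] compact_imp_closed by simp
    moreover have "interior (K + K) = {}"
    proof (rule ccontr)
      assume "interior (K + K) \<noteq> {}"
      then obtain x where "x \<in> interior (K + K)" by blast
      then obtain C where "C \<in> \<B>" "x \<in> C" "C \<subseteq> interior (K + K)"
        using topological_basisE[OF \<B>(2) open_interior] by metis
      moreover from \<open>C \<in> \<B>\<close> obtain n where "C = W n"
        unfolding W_def using from_nat_into_surj[OF \<B>(1)] by metis
      ultimately have n: "W n \<noteq> {}" "W n \<subseteq> interior (K + K)" by auto
      have "K \<subseteq> V (Suc n)" by (auto simp: K_def)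
      then have "K + K \<subseteq> V (Suc n) + V (Suc n)" by (intro set_plus_mono2)
      then show False using avoid[OF n(1)] n(2) interior_subset by blast
    qed
    ultimately show ?thesis by (simp add: nowhere_dense_def)
  qed
  ultimately show ?thesis by blast
qed

end
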